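(* Let $n\geq 1$ be an integer. The generating function for the number of co-even dominating sets of the complete graph $K_n$ is: (i) $D_{coe}(K_n,x)=x^{n}$, if $n$ is even. (ii) $D_{coe}(K_n,x)=\sum_{i=1}^{n}\binom{n}{i}x^{i}$, if $n$ is odd.
   Context: $K_n$ is the complete graph on $n$ vertices. For a finite simple graph $G=(V,E)$, a set $D\subseteq V$ is a dominating set if every vertex of $V-D$ is adjacent to at least one vertex of $D$; a dominating set $D$ is a co-even dominating set if the degree in $G$ of every vertex of $V-D$ is even. $d_{coe}(G,i)$ denotes the number of co-even dominating sets of $G$ of cardinality $i$, and $D_{coe}(G,x)=\sum_{i=1}^{|V|}d_{coe}(G,i)x^i$. *)

theory Defs
  imports "Graph_Theory.Graph_Theory" "HOL-Computational_Algebra.Polynomial"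
begin

text \<open>
  Finite simple graphs are the members of the locale \<^locale>\<open>graph\<close>: finite symmetric digraphs
  without loops and multiple arcs. An edge is represented by the two opposite arcs between its
  ends, so the degree of a vertex is its \<^const>\<open>out_degree\<close> (the number of its neighbours).
\<close>

definition dominating_set :: "('a, 'b) pre_digraph \<Rightarrow> 'a set \<Rightarrow> bool" where
  "dominating_set G D \<longleftrightarrow>
    D \<subseteq> verts G \<and> (\<forall>v \<in> verts G - D. \<exists>u \<in> D. v \<rightarrow>\<^bsub>G\<^esub> u)"

definition coeven_dominating_set :: "('a, 'b) pre_digraph \<Rightarrow> 'a set \<Rightarrow> bool" where
  "coeven_dominating_set G D \<longleftrightarrow>
    dominating_set G D \<and> (\<forall>v \<in> verts G - D. even (out_degree G v))"

definition d_coe :: "('a, 'b) pre_digraph \<Rightarrow> nat \<Rightarrow> nat" where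
  "d_coe G i = card {D. coeven_dominating_set G D \<and> card D = i}"

definition D_coe :: "('a, 'b) pre_digraph \<Rightarrow> int poly" where
  "D_coe G = (\<Sum>i = 1..card (verts G). monom (int (d_coe G i)) i)"

text \<open>
  \<^const>\<open>complete_digraph\<close> is a predicate (being a complete graph on \<open>n\<close> vertices); it is
  satisfiable for every \<open>n\<close>.
\<close>

lemma complete_digraph_exists: "\<exists>G :: (nat, nat \<times> nat) pre_digraph. K\<^bsub>n\<^esub> G"
proof -
  let ?G = "\<lparr>pverts = {..<n}, parcs = {(u, v). u < n \<and> v < n \<and> u \<noteq> v}\<rparr>"
  have "K\<^bsub>n\<^esub> (with_proj ?G)"
    unfolding complete_digraph_pair_def by auto
  then show ?thesis by blast
qed

end

theory Submission
  imports Defs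
begin

text \<open>In a complete graph any single vertex dominates all the others, so the dominating sets
  are exactly the nonempty vertex sets. All degrees equal \<open>n - 1\<close>, so parity treats all
  vertices alike. For odd \<open>n\<close> it excludes nothing, and counting nonempty subsets by
  size gives the binomial coefficients. For even \<open>n\<close> no vertex may lie outside
  \<open>D\<close>, which leaves only the full vertex set.
  \<open>coeven_dominating_set_complete_digraph\<close> combines both facts; the rest is
  counting.\<close>

lemma out_degree_complete_digraph:
  assumes "K\<^bsub>n\<^esub> G" and v: "v \<in> verts G"
  shows "out_degree G v = n - 1"
proof -
  interpret graph G
    using assms by (simp add: complete_digraph_def)
  have ends: "arcs_ends G = {(u, v). (u, v) \<in> verts G \<times> verts G \<and> u \<noteq> v}"
    and card_verts: "card (verts G) = n"
    using assms by (simp_all add: complete_digraph_def)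
  \<comment> \<open>Arcs leaving \<open>v\<close> share their tail, so two with the same head would
    be parallel. Hence counting out-arcs amounts to counting neighbours.\<close>
  have "inj_on (head G) (out_arcs G v)"
    by (rule inj_onI) (auto simp: arc_to_ends_def intro: no_multi_arcs)
  moreover have "head G ` out_arcs G v = {u. v \<rightarrow>\<^bsub>G\<^esub> u}"
    by (auto simp: arcs_ends_conv)
  moreover have "{u. v \<rightarrow>\<^bsub>G\<^esub> u} = verts G - {v}"
    using v by (auto simp: ends)
  ultimately show ?thesis
    using card_image[of "head G" "out_arcs G v"] v card_verts
    by (simp add: out_degree_def)
qed

text \<open>A vertex outside \<open>D\<close> differs from every element of \<open>D\<close>, hence
  is adjacent to each of them. The bound on \<open>n\<close> rules out the empty graph, which the
  empty set dominates.\<close>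

lemma dominating_set_complete_digraph:
  assumes "K\<^bsub>n\<^esub> G" and "n \<ge> 1"
  shows "dominating_set G D \<longleftrightarrow> D \<subseteq> verts G \<and> D \<noteq> {}"
proof -
  have ends: "arcs_ends G = {(u, v). (u, v) \<in> verts G \<times> verts G \<and> u \<noteq> v}"
    and "verts G \<noteq> {}"
    using assms by (auto simp: complete_digraph_def)
  then show ?thesis
    by (auto simp: dominating_set_def)
qed

text \<open>Since \<open>n \<ge> 1\<close>, the common degree \<open>n - 1\<close> is even iff
  \<open>n\<close> is odd; for even \<open>n\<close> the parity condition can hold only vacuously,
  when \<open>verts G - D\<close> is empty.\<close>

lemma coeven_dominating_set_complete_digraph:
  assumes "K\<^bsub>n\<^esub> G" and "n \<ge> 1"
  shows "coeven_dominating_set G D \<longleftrightarrow>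
    D \<subseteq> verts G \<and> D \<noteq> {} \<and> (odd n \<or> D = verts G)"
  using assms out_degree_complete_digraph[OF assms(1)]
  by (auto simp: coeven_dominating_set_def dominating_set_complete_digraph)

theorem corollary4p8:
  fixes n :: nat and G :: "('a, 'b) pre_digraph"
  assumes "n \<ge> 1" and "K\<^bsub>n\<^esub> G"
  shows "(even n \<longrightarrow> D_coe G = monom 1 n) \<and>
         (odd n \<longrightarrow> D_coe G = (\<Sum>i = 1..n. monom (int (n choose i)) i))"
proof -
  interpret graph G
    using assms by (simp add: complete_digraph_def)
  have card_verts: "card (verts G) = n"
    using assms by (simp add: complete_digraph_def)
  note coeven = coeven_dominating_set_complete_digraph[OF assms(2,1)]
  have "D_coe G = monom 1 n" if "even n"
  proof -
    have "verts G \<noteq> {}"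
      using assms(1) card_verts by auto
    then have "{D. coeven_dominating_set G D \<and> card D = i} = (if i = n then {verts G} else {})" for i
      using that card_verts by (auto simp: coeven)
    then have "d_coe G i = (if i = n then 1 else 0)" for i
      by (simp add: d_coe_def)
    then have "D_coe G = (\<Sum>i = 1..n. if i = n then monom 1 i else 0)"
      unfolding D_coe_def card_verts by (intro sum.cong) auto
    \<comment> \<open>The one nonzero term is in the range of summation because
      \<open>n \<ge> 1\<close>.\<close>
    then show ?thesis
      using assms(1) by simp
  qed
  moreover have "D_coe G = (\<Sum>i = 1..n. monom (int (n choose i)) i)" if "odd n"
  proof -
    \<comment> \<open>The bound on \<open>i\<close> makes every counted set nonempty; at
      \<open>i = 0\<close> the two sides would be 0 and 1.\<close>
    have "d_coe G i = n choose i" if "i \<ge> 1" for i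
    proof -
      have "{D. coeven_dominating_set G D \<and> card D = i} = {D. D \<subseteq> verts G \<and> card D = i}"
        using that \<open>odd n\<close> by (auto simp: coeven)
      then show ?thesis
        by (simp add: d_coe_def n_subsets card_verts)
    qed
    then show ?thesis
      unfolding D_coe_def card_verts by (intro sum.cong) auto
  qed
  ultimately show ?thesis
    by blast
qed

end
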